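(* Let $n$ be a positive integer, and let $R_1$ and $R_2$ be the $(n+1)$-dimensional complex solvable Leibniz algebras with basis $\{f_1,\dots,f_n,x\}$ and the following multiplications (all other products of basis elements being zero): $$R_1:\quad [f_i,x]=f_i+f_{i+1}\ (1\le i\le n-1),\qquad [f_n,x]=f_n;$$ $$R_2:\quad [f_i,x]=f_i+f_{i+1},\quad [x,f_i]=-f_i-f_{i+1}\ (1\le i\le n-1),\qquad [f_n,x]=f_n,\quad [x,f_n]=-f_n.$$ Then each of $R_1$ and $R_2$ admits a local derivation which is not a derivation.
   Context: A (right) Leibniz algebra is a vector space $\mathcal L$ with a bilinear bracket satisfying $[x,[y,z]]=[[x,y],z]-[[x,z],y]$ for all $x,y,z$. A derivation of $\mathcal L$ is a linear map $D:\mathcal L\to\mathcal L$ with $D([x,y])=[D(x),y]+[x,D(y)]$ for all $x,y\in\mathcal L$. A local derivation of $\mathcal L$ is a linear map $\Delta:\mathcal L\to\mathcal L$ such that for every $x\in\mathcal L$ there is a derivation $D_x$ of $\mathcal L$ (depending on $x$) with $\Delta(x)=D_x(x)$.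
   Formalization: The formal theorem assumes n at least 2 instead of n a positive integer, because for n = 1 every local derivation of R_1 and of R_2 is a derivation, so the claim is false there. *)

theory Defs
  imports "HOL-Analysis.Analysis"
begin

locale leibniz_algebra = vector_space scale
  for scale :: "'k::field \<Rightarrow> 'a::ab_group_add \<Rightarrow> 'a" (infixr \<open>\<odot>\<close> 75) +
  fixes bracket :: "'a \<Rightarrow> 'a \<Rightarrow> 'a" (\<open>\<lbrakk>_,/ _\<rbrakk>\<close>)
  assumes bracket_linear_left: "Vector_Spaces.linear scale scale (\<lambda>a. \<lbrakk>a, b\<rbrakk>)"
    and bracket_linear_right: "Vector_Spaces.linear scale scale (\<lambda>b. \<lbrakk>a, b\<rbrakk>)"
    and leibniz: "\<lbrakk>a, \<lbrakk>b, c\<rbrakk>\<rbrakk> = \<lbrakk>\<lbrakk>a, b\<rbrakk>, c\<rbrakk> - \<lbrakk>\<lbrakk>a, c\<rbrakk>, b\<rbrakk>"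
begin

definition derivation :: "('a \<Rightarrow> 'a) \<Rightarrow> bool" where
  "derivation D \<longleftrightarrow> Vector_Spaces.linear scale scale D \<and>
     (\<forall>a b. D \<lbrakk>a, b\<rbrakk> = \<lbrakk>D a, b\<rbrakk> + \<lbrakk>a, D b\<rbrakk>)"

definition local_derivation :: "('a \<Rightarrow> 'a) \<Rightarrow> bool" where
  "local_derivation \<Delta> \<longleftrightarrow> Vector_Spaces.linear scale scale \<Delta> \<and>
     (\<forall>a. \<exists>D. derivation D \<and> \<Delta> a = D a)"

fun derived :: "nat \<Rightarrow> 'a set" where
  "derived 0 = UNIV"
| "derived (Suc k) = span {\<lbrakk>a, b\<rbrakk> | a b. a \<in> derived k \<and> b \<in> derived k}"

definition solvable :: bool where
  "solvable \<longleftrightarrow> (\<exists>k. derived k = {0})"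

end

locale leibniz_algebra_basis = leibniz_algebra scale bracket
  for scale :: "complex \<Rightarrow> 'a::ab_group_add \<Rightarrow> 'a" (infixr \<open>\<odot>\<close> 75)
    and bracket :: "'a \<Rightarrow> 'a \<Rightarrow> 'a" (\<open>\<lbrakk>_,/ _\<rbrakk>\<close>) +
  fixes n :: nat and f :: "nat \<Rightarrow> 'a" and x :: 'a
  assumes n_pos: "1 \<le> n"
    and inj_f: "inj_on f {1..n}"
    and x_notin: "x \<notin> f ` {1..n}"
    and independent_basis: "independent (insert x (f ` {1..n}))"
    and span_basis: "span (insert x (f ` {1..n})) = UNIV"

text \<open>
  \<open>R1 scale bracket n f x\<close> says that the whole type, with the given scalar multiplication and
  bracket, is the algebra \<open>R\<^sub>1\<close> with basis \<open>f 1, \<dots>, f n, x\<close>. The product table determines the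
  bracket by bilinearity. The values of \<open>f\<close> outside \<open>{1..n}\<close> are irrelevant.
\<close>

locale R1 = leibniz_algebra_basis scale bracket n f x
  for scale :: "complex \<Rightarrow> 'a::ab_group_add \<Rightarrow> 'a" (infixr \<open>\<odot>\<close> 75)
    and bracket :: "'a \<Rightarrow> 'a \<Rightarrow> 'a" (\<open>\<lbrakk>_,/ _\<rbrakk>\<close>) and n f x +
  assumes f_x: "\<And>i. 1 \<le> i \<Longrightarrow> i \<le> n - 1 \<Longrightarrow> \<lbrakk>f i, x\<rbrakk> = f i + f (i + 1)"
    and fn_x: "\<lbrakk>f n, x\<rbrakk> = f n"
    and x_f: "\<And>i. 1 \<le> i \<Longrightarrow> i \<le> n \<Longrightarrow> \<lbrakk>x, f i\<rbrakk> = 0"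
    and f_f: "\<And>i j. 1 \<le> i \<Longrightarrow> i \<le> n \<Longrightarrow> 1 \<le> j \<Longrightarrow> j \<le> n \<Longrightarrow> \<lbrakk>f i, f j\<rbrakk> = 0"
    and x_x: "\<lbrakk>x, x\<rbrakk> = 0"

locale R2 = leibniz_algebra_basis scale bracket n f x
  for scale :: "complex \<Rightarrow> 'a::ab_group_add \<Rightarrow> 'a" (infixr \<open>\<odot>\<close> 75)
    and bracket :: "'a \<Rightarrow> 'a \<Rightarrow> 'a" (\<open>\<lbrakk>_,/ _\<rbrakk>\<close>) and n f x +
  assumes f_x: "\<And>i. 1 \<le> i \<Longrightarrow> i \<le> n - 1 \<Longrightarrow> \<lbrakk>f i, x\<rbrakk> = f i + f (i + 1)"
    and x_f: "\<And>i. 1 \<le> i \<Longrightarrow> i \<le> n - 1 \<Longrightarrow> \<lbrakk>x, f i\<rbrakk> = - f i - f (i + 1)"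
    and fn_x: "\<lbrakk>f n, x\<rbrakk> = f n"
    and x_fn: "\<lbrakk>x, f n\<rbrakk> = - f n"
    and f_f: "\<And>i j. 1 \<le> i \<Longrightarrow> i \<le> n \<Longrightarrow> 1 \<le> j \<Longrightarrow> j \<le> n \<Longrightarrow> \<lbrakk>f i, f j\<rbrakk> = 0"
    and x_x: "\<lbrakk>x, x\<rbrakk> = 0"

text \<open>Both algebras are solvable.\<close>

context leibniz_algebra
begin

lemma bracket_add_left: "\<lbrakk>a + a', b\<rbrakk> = \<lbrakk>a, b\<rbrakk> + \<lbrakk>a', b\<rbrakk>"
  and bracket_scale_left: "\<lbrakk>r \<odot> a, b\<rbrakk> = r \<odot> \<lbrakk>a, b\<rbrakk>"
  using bracket_linear_left[of b] by (simp_all add: Vector_Spaces.linear_iff)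

lemma bracket_add_right: "\<lbrakk>b, a + a'\<rbrakk> = \<lbrakk>b, a\<rbrakk> + \<lbrakk>b, a'\<rbrakk>"
  and bracket_scale_right: "\<lbrakk>b, r \<odot> a\<rbrakk> = r \<odot> \<lbrakk>b, a\<rbrakk>"
  using bracket_linear_right[of b] by (simp_all add: Vector_Spaces.linear_iff)

lemma bracket_zero_left: "\<lbrakk>0, b\<rbrakk> = 0" and bracket_zero_right: "\<lbrakk>b, 0\<rbrakk> = 0"
  using bracket_scale_left[of 0 0 b] bracket_scale_right[of b 0 0] by simp_all

lemma bracket_in_subspace:
  assumes "subspace W" and "\<And>a b. a \<in> A \<Longrightarrow> b \<in> B \<Longrightarrow> \<lbrakk>a, b\<rbrakk> \<in> W"
    and "u \<in> span A" and "v \<in> span B"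
  shows "\<lbrakk>u, v\<rbrakk> \<in> W"
proof -
  have *: "\<lbrakk>a, v\<rbrakk> \<in> W" if "a \<in> A" for a
    using \<open>v \<in> span B\<close>
  proof (induction rule: span_induct_alt)
    case base
    then show ?case using assms(1) by (simp add: bracket_zero_right subspace_0)
  next
    case (step c y z)
    then show ?case
      using assms(1,2) that
      by (simp add: bracket_add_right bracket_scale_right subspace_add subspace_scale)
  qed
  show ?thesis
    using \<open>u \<in> span A\<close>
  proof (induction rule: span_induct_alt)
    case base
    then show ?case using assms(1) by (simp add: bracket_zero_left subspace_0)
  next
    case (step c y z)
    then show ?case
      using assms(1) *
      by (simp add: bracket_add_left bracket_scale_left subspace_add subspace_scale)
  qed
qed

lemma solvableI:
  assumes "\<And>a b. a \<in> insert x F \<Longrightarrow> b \<in> insert x F \<Longrightarrow> \<lbrakk>a, b\<rbrakk> \<in> span F"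
    and "span (insert x F) = UNIV" and "\<And>a b. a \<in> F \<Longrightarrow> b \<in> F \<Longrightarrow> \<lbrakk>a, b\<rbrakk> = 0"
  shows solvable
proof -
  have 1: "\<lbrakk>a, b\<rbrakk> \<in> span F" for a b
    by (rule bracket_in_subspace[of _ "insert x F" "insert x F"])
      (simp_all only: assms(1,2) subspace_span UNIV_I)
  have 2: "\<lbrakk>a, b\<rbrakk> \<in> {0}" if "a \<in> span F" "b \<in> span F" for a b
    using bracket_in_subspace[of "{0}", OF _ _ that] assms(3) by simp
  have "{\<lbrakk>a, b\<rbrakk> | a b. a \<in> derived 0 \<and> b \<in> derived 0} \<subseteq> span F"
    using 1 by blast
  then have "derived 1 \<subseteq> span F"
    using span_minimal[OF _ subspace_span] by simp
  then have "{\<lbrakk>a, b\<rbrakk> | a b. a \<in> derived 1 \<and> b \<in> derived 1} \<subseteq> {0}"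
    using 2 by blast
  then have "derived (Suc 1) \<subseteq> {0}"
    using span_minimal[of _ "{0}"] by simp
  moreover have "0 \<in> derived (Suc 1)" by (simp add: span_zero)
  ultimately show ?thesis unfolding solvable_def by blast
qed

lemma derivationD:
  assumes "derivation D"
  shows "D (a + b) = D a + D b" "D (r \<odot> a) = r \<odot> D a" "D \<lbrakk>a, b\<rbrakk> = \<lbrakk>D a, b\<rbrakk> + \<lbrakk>a, D b\<rbrakk>"
  using assms unfolding derivation_def by (simp_all add: Vector_Spaces.linear_iff)

end

lemma (in leibniz_algebra_basis) f_in_span: "1 \<le> i \<Longrightarrow> i \<le> n \<Longrightarrow> f i \<in> span (f ` {1..n})"
  by (rule span_base) auto

lemma (in R1) solvable: solvable
proof (rule solvableI[of x "f ` {1..n}"])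
  have fx: "\<lbrakk>f i, x\<rbrakk> \<in> span (f ` {1..n})" if "1 \<le> i" "i \<le> n" for i
  proof (cases "i = n")
    case True
    then show ?thesis using fn_x f_in_span[OF that] by simp
  next
    case False
    then have "i \<le> n - 1" "i + 1 \<le> n" using that by auto
    then show ?thesis
      using that f_in_span[of i] f_in_span[of "i + 1"]
      by (simp only: f_x span_add le_add2)
  qed
  show "\<lbrakk>a, b\<rbrakk> \<in> span (f ` {1..n})"
    if "a \<in> insert x (f ` {1..n})" "b \<in> insert x (f ` {1..n})" for a b
    using that by (elim insertE imageE) (simp_all add: fx x_f f_f x_x span_zero del: One_nat_def)
qed (use span_basis f_f in auto)

lemma (in R2) solvable: solvable
proof (rule solvableI[of x "f ` {1..n}"])
  have fx: "\<lbrakk>f i, x\<rbrakk> \<in> span (f ` {1..n})" if "1 \<le> i" "i \<le> n" for i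
  proof (cases "i = n")
    case True
    then show ?thesis using fn_x f_in_span[OF that] by simp
  next
    case False
    then have "i \<le> n - 1" "i + 1 \<le> n" using that by auto
    then show ?thesis
      using that f_in_span[of i] f_in_span[of "i + 1"]
      by (simp only: f_x span_add le_add2)
  qed
  have xf: "\<lbrakk>x, f i\<rbrakk> \<in> span (f ` {1..n})" if "1 \<le> i" "i \<le> n" for i
  proof (cases "i = n")
    case True
    then show ?thesis using x_fn f_in_span[OF that] by (simp add: span_neg)
  next
    case False
    then have "i \<le> n - 1" "i + 1 \<le> n" using that by auto
    then show ?thesis
      using that f_in_span[of i] f_in_span[of "i + 1"]
      by (simp only: x_f span_diff span_neg le_add2)
  qed
  show "\<lbrakk>a, b\<rbrakk> \<in> span (f ` {1..n})"
    if "a \<in> insert x (f ` {1..n})" "b \<in> insert x (f ` {1..n})" for a b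
    using that by (elim insertE imageE) (simp_all add: fx xf f_f x_x span_zero del: One_nat_def)
qed (use span_basis f_f in auto)

text \<open>
  Both algebras exist for every \<open>n \<ge> 1\<close>. In the model on \<open>complex ^ 'm\<close>, \<open>g\<close> enumerates the index type
  with inverse \<open>h\<close>, coordinate \<open>g 0\<close> belongs to \<open>x\<close>, and \<open>table_op g h\<close> is the bracket with \<open>x\<close> on
  the right.
\<close>

definition table_op :: "(nat \<Rightarrow> 'm) \<Rightarrow> ('m \<Rightarrow> nat) \<Rightarrow> complex ^ 'm \<Rightarrow> complex ^ 'm::finite" where
  "table_op g h u = (\<chi> j. if h j = 0 then 0
     else if h j = 1 then u $ j else u $ j + u $ g (h j - 1))"

lemma table_op_linear:
  "table_op g h (u + v) = table_op g h u + table_op g h v"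
  "table_op g h (r *s u) = r *s table_op g h u"
  by (auto simp: table_op_def vec_eq_iff algebra_simps)

lemma table_models:
  assumes "CARD('m::finite) = n + 1" "1 \<le> n"
  shows "\<exists>br f (x :: complex ^ 'm). R1 (*s) br n f x"
    and "\<exists>br f (x :: complex ^ 'm). R2 (*s) br n f x"
proof -
  obtain g :: "nat \<Rightarrow> 'm" where g: "bij_betw g {0..n} UNIV"
    using ex_bij_betw_nat_finite[of "UNIV :: 'm set"] assms(1)
    by (auto simp: atLeastLessThanSuc_atLeastAtMost)
  define h where "h = the_inv_into {0..n} g"
  have hg: "h (g i) = i" if "i \<le> n" for i
    using that g unfolding h_def by (auto simp: bij_betw_def intro: the_inv_into_f_f)
  have hn: "h j \<le> n" and gh: "g (h j) = j" for j
    using g unfolding h_def bij_betw_def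
    by (auto intro!: f_the_inv_into_f the_inv_into_into[of g "{0..n}" j "{0..n}", simplified])
  have g_eq: "g i = g j \<longleftrightarrow> i = j" if "i \<le> n" "j \<le> n" for i j
    using hg that by metis
  define f where "f i = (axis (g i) 1 :: complex ^ 'm)" for i
  define x where "x = (axis (g 0) 1 :: complex ^ 'm)"
  let ?T = "table_op g h"
  have T0: "?T u $ g 0 = 0" for u
    by (simp add: table_op_def hg)
  have eqI: "u = v" if "\<And>k. k \<le> n \<Longrightarrow> u $ g k = v $ g k" for u v :: "complex ^ 'm"
    using that[OF hn] by (simp add: vec_eq_iff gh)
  have T: "?T u $ g k = (if k = 0 then 0 else if k = 1 then u $ g k else u $ g k + u $ g (k - 1))"
    if "k \<le> n" for u k
    using that by (simp add: table_op_def hg)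
  have f: "f i $ g k = (if k = i then 1 else 0)" if "i \<le> n" "k \<le> n" for i k
    using that by (auto simp: f_def axis_def g_eq)
  have x: "x $ g k = (if k = 0 then 1 else 0)" if "k \<le> n" for k
    using that by (auto simp: x_def axis_def g_eq)
  have Tx: "?T x = 0"
    by (rule eqI) (auto simp: T x)
  have Tfn: "?T (f n) = f n"
    by (rule eqI) (use assms(2) in \<open>auto simp: T f\<close>)
  have Tf: "?T (f i) = f i + f (i + 1)" if "1 \<le> i" "i \<le> n - 1" for i
    by (rule eqI) (use that assms(2) in \<open>auto simp: T f\<close>)
  have f0: "f i $ g 0 = 0" if "1 \<le> i" "i \<le> n" for i
    using that by (simp add: f_def axis_def g_eq)
  have x0: "x $ g 0 = 1" by (simp add: x_def axis_def)
  have ins: "insert x (f ` {1..n}) = cart_basis"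
  proof -
    have "insert x (f ` {1..n}) = (\<lambda>i. axis (g i) 1) ` insert 0 {1..n}"
      by (simp add: f_def x_def image_image)
    also have "insert 0 {1..n} = {0..n}" by auto
    also have "(\<lambda>i. axis (g i) 1) ` {0..n} = (\<lambda>j. axis j (1::complex)) ` (g ` {0..n})"
      by (simp add: image_image)
    also have "g ` {0..n} = UNIV" using g by (simp add: bij_betw_def)
    finally show ?thesis by (auto simp: cart_basis_def)
  qed
  have basis: "inj_on f {1..n}" "x \<notin> f ` {1..n}"
    by (auto simp: inj_on_def f_def x_def axis_eq_axis g_eq)
  have T_minus: "?T (u - v) = ?T u - ?T v" for u v
    using table_op_linear(1)[of g h "u - v" v] by simp
  have vs: "Vector_Spaces.linear (*s) (*s) F \<longleftrightarrow>
      (\<forall>u v. F (u + v) = F u + F v) \<and> (\<forall>r u. F (r *s u) = r *s F u)"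
    for F :: "complex ^ 'm \<Rightarrow> complex ^ 'm"
    by (auto simp: Vector_Spaces.linear_iff vec.vector_space_axioms)
  have "R1 (*s) (\<lambda>u v. (v $ g 0) *s ?T u) n f x"
  proof (intro R1.intro R1_axioms.intro leibniz_algebra_basis.intro
      leibniz_algebra_basis_axioms.intro leibniz_algebra.intro leibniz_algebra_axioms.intro
      vec.vector_space_axioms)
    show "Vector_Spaces.linear (*s) (*s) (\<lambda>u. (v $ g 0) *s ?T u)" for v
      by (simp add: vs T_minus table_op_linear vector_add_ldistrib vector_sadd_rdistrib
          vector_ssub_ldistrib vector_smult_assoc mult.commute)
    show "Vector_Spaces.linear (*s) (*s) (\<lambda>v. (v $ g 0) *s ?T u)" for u
      by (simp add: vs T_minus table_op_linear vector_add_ldistrib vector_sadd_rdistrib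
          vector_ssub_ldistrib vector_smult_assoc mult.commute)
    show "(((w $ g 0) *s ?T v) $ g 0) *s ?T u =
        (w $ g 0) *s ?T ((v $ g 0) *s ?T u) -
        ((v $ g 0) *s ?T ((w $ g 0) *s ?T u))" for u v w
      by (simp add: T_minus table_op_linear T0 vector_ssub_ldistrib vector_smult_assoc
          mult.commute)
    show "1 \<le> n" "inj_on f {1..n}" "x \<notin> f ` {1..n}"
      using assms(2) basis by auto
    show "vec.independent (insert x (f ` {1..n}))" "vec.span (insert x (f ` {1..n})) = UNIV"
      unfolding ins by (rule independent_cart_basis span_cart_basis)+
  qed (auto simp: x0 f0 Tx Tfn Tf)
  then show "\<exists>br f (x :: complex ^ 'm). R1 (*s) br n f x" by blast
  have "R2 (*s) (\<lambda>u v. (v $ g 0) *s ?T u - (u $ g 0) *s ?T v) n f x"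
  proof (intro R2.intro R2_axioms.intro leibniz_algebra_basis.intro
      leibniz_algebra_basis_axioms.intro leibniz_algebra.intro leibniz_algebra_axioms.intro
      vec.vector_space_axioms)
    show "Vector_Spaces.linear (*s) (*s) (\<lambda>u. (v $ g 0) *s ?T u - (u $ g 0) *s ?T v)" for v
      by (simp add: vs T_minus table_op_linear vector_add_ldistrib vector_sadd_rdistrib
          vector_ssub_ldistrib vector_smult_assoc mult.commute)
    show "Vector_Spaces.linear (*s) (*s) (\<lambda>v. (v $ g 0) *s ?T u - (u $ g 0) *s ?T v)" for u
      by (simp add: vs T_minus table_op_linear vector_add_ldistrib vector_sadd_rdistrib
          vector_ssub_ldistrib vector_smult_assoc mult.commute)
    show "(((w $ g 0) *s ?T v - (v $ g 0) *s ?T w) $ g 0) *s ?T u - (u $ g 0) *s ?T ((w $ g 0) *s ?T v - (v $ g 0) *s ?T w) =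
        (w $ g 0) *s ?T ((v $ g 0) *s ?T u - (u $ g 0) *s ?T v) - (((v $ g 0) *s ?T u - (u $ g 0) *s ?T v) $ g 0) *s ?T w -
        ((v $ g 0) *s ?T ((w $ g 0) *s ?T u - (u $ g 0) *s ?T w) - (((w $ g 0) *s ?T u - (u $ g 0) *s ?T w) $ g 0) *s ?T v)" for u v w
      by (simp add: T_minus table_op_linear T0 vector_ssub_ldistrib vector_smult_assoc
          mult.commute)
    show "1 \<le> n" "inj_on f {1..n}" "x \<notin> f ` {1..n}"
      using assms(2) basis by auto
    show "vec.independent (insert x (f ` {1..n}))" "vec.span (insert x (f ` {1..n})) = UNIV"
      unfolding ins by (rule independent_cart_basis span_cart_basis)+
  qed (auto simp: x0 f0 Tx Tfn Tf)
  then show "\<exists>br f (x :: complex ^ 'm). R2 (*s) br n f x" by blast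
qed

text \<open>
  For \<open>n = 1\<close> every local derivation of either algebra is a derivation, so a local derivation
  that is not a derivation can only be expected for \<open>n \<ge> 2\<close>.
\<close>

lemma (in leibniz_algebra_basis) coords_1:
  assumes "n = 1"
  obtains a b where "v = a \<odot> f 1 + b \<odot> x"
proof -
  have "v \<in> span {x, f 1}" using span_basis assms by simp
  then obtain b where "v - b \<odot> x \<in> span {f 1}" unfolding span_insert by blast
  then obtain a where "v - b \<odot> x = a \<odot> f 1" unfolding span_singleton by blast
  then show thesis using that by (metis diff_add_cancel)
qed

lemma (in leibniz_algebra_basis) coords_1_eq:
  assumes "n = 1" "a \<odot> f 1 + b \<odot> x = a' \<odot> f 1 + b' \<odot> x"
  shows "a = a' \<and> b = b'"
proof -
  have ne: "x \<noteq> f 1" and ind: "independent {x, f 1}"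
    using x_notin independent_basis assms(1) by auto
  define u where "u v = (if v = x then b - b' else a - a')" for v
  have "(\<Sum>v\<in>{x, f 1}. u v \<odot> v) = 0"
    using ne assms(2) by (simp add: u_def scale_left_diff_distrib algebra_simps)
  then have "u v = 0" if "v \<in> {x, f 1}" for v
    using independentD[OF ind _ subset_refl, of u v] that by blast
  from this[of x] this[of "f 1"] show ?thesis using ne by (auto simp: u_def)
qed

lemma (in R1) local_derivation_dim_2:
  assumes "n = 1" "local_derivation \<Delta>"
  shows "derivation \<Delta>"
proof -
  have D: "(\<exists>p. D (f 1) = p \<odot> f 1) \<and> D x = 0" if "derivation D" for D
  proof -
    obtain p q where p: "D (f 1) = p \<odot> f 1 + q \<odot> x" using coords_1[OF assms(1)] by blast
    obtain r t where r: "D x = r \<odot> f 1 + t \<odot> x" using coords_1[OF assms(1)] by blast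
    note br = derivationD[OF that] 
    have "D \<lbrakk>f 1, x\<rbrakk> = (p + t) \<odot> f 1 + 0 \<odot> x"
      unfolding br(3) p r using fn_x x_x f_f[of 1 1] assms(1)
      by (simp add: bracket_add_left bracket_add_right bracket_scale_left bracket_scale_right
          scale_left_distrib)
    then have "p \<odot> f 1 + q \<odot> x = (p + t) \<odot> f 1 + 0 \<odot> x"
      using fn_x assms(1) p by simp
    from coords_1_eq[OF assms(1) this] have qt: "q = 0" "t = 0" by auto
    have "D \<lbrakk>x, x\<rbrakk> = r \<odot> f 1"
      unfolding br(3) p r using fn_x x_x x_f[of 1] assms(1) qt
      by (simp add: bracket_add_left bracket_add_right bracket_scale_left bracket_scale_right)
    moreover have "D 0 = 0" using br(2)[of 0 0] by simp
    ultimately show ?thesis using p r qt x_x by auto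
  qed
  have lin: "Vector_Spaces.linear scale scale \<Delta>"
    and pt: "\<And>a. \<exists>D. derivation D \<and> \<Delta> a = D a"
    using assms(2) by (auto simp: local_derivation_def)
  obtain p where p: "\<Delta> (f 1) = p \<odot> f 1" using pt[of "f 1"] D by force
  have r: "\<Delta> x = 0" using pt[of x] D by force
  have "\<Delta> \<lbrakk>u, v\<rbrakk> = \<lbrakk>\<Delta> u, v\<rbrakk> + \<lbrakk>u, \<Delta> v\<rbrakk>" for u v
  proof -
    obtain a b where u: "u = a \<odot> f 1 + b \<odot> x" using coords_1[OF assms(1)] by blast
    obtain c d where v: "v = c \<odot> f 1 + d \<odot> x" using coords_1[OF assms(1)] by blast
    have add: "\<Delta> (y + z) = \<Delta> y + \<Delta> z" and scale: "\<Delta> (e \<odot> y) = e \<odot> \<Delta> y" for y z e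
      using lin by (simp_all add: Vector_Spaces.linear_iff)
    have diff: "\<Delta> (y - z) = \<Delta> y - \<Delta> z" for y z
      using add[of "y - z" z] by simp
    show ?thesis
      using fn_x x_x f_f[of 1 1] x_f[of 1] assms(1)
      by (simp add: u v p[simplified] r add scale diff bracket_add_left bracket_add_right bracket_scale_left
          bracket_scale_right scale_right_distrib scale_right_diff_distrib scale_left_diff_distrib scale_left_distrib bracket_zero_right
         
          algebra_simps)
  qed
  with lin show ?thesis by (simp add: derivation_def)
qed

lemma (in R2) local_derivation_dim_2:
  assumes "n = 1" "local_derivation \<Delta>"
  shows "derivation \<Delta>"
proof -
  have D: "(\<exists>p. D (f 1) = p \<odot> f 1) \<and> (\<exists>r. D x = r \<odot> f 1)" if "derivation D" for D
  proof -
    obtain p q where p: "D (f 1) = p \<odot> f 1 + q \<odot> x" using coords_1[OF assms(1)] by blast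
    obtain r t where r: "D x = r \<odot> f 1 + t \<odot> x" using coords_1[OF assms(1)] by blast
    note br = derivationD[OF that] 
    have "D \<lbrakk>f 1, x\<rbrakk> = (p + t) \<odot> f 1 + 0 \<odot> x"
      unfolding br(3) p r using fn_x x_x f_f[of 1 1] assms(1)
      by (simp add: bracket_add_left bracket_add_right bracket_scale_left bracket_scale_right
          scale_left_distrib)
    then have "p \<odot> f 1 + q \<odot> x = (p + t) \<odot> f 1 + 0 \<odot> x"
      using fn_x assms(1) p by simp
    from coords_1_eq[OF assms(1) this] have qt: "q = 0" "t = 0" by auto
    then show ?thesis using p r by auto
  qed
  have lin: "Vector_Spaces.linear scale scale \<Delta>"
    and pt: "\<And>a. \<exists>D. derivation D \<and> \<Delta> a = D a"
    using assms(2) by (auto simp: local_derivation_def)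
  obtain p where p: "\<Delta> (f 1) = p \<odot> f 1" using pt[of "f 1"] D by force
  obtain r where r: "\<Delta> x = r \<odot> f 1" using pt[of x] D by force
  have "\<Delta> \<lbrakk>u, v\<rbrakk> = \<lbrakk>\<Delta> u, v\<rbrakk> + \<lbrakk>u, \<Delta> v\<rbrakk>" for u v
  proof -
    obtain a b where u: "u = a \<odot> f 1 + b \<odot> x" using coords_1[OF assms(1)] by blast
    obtain c d where v: "v = c \<odot> f 1 + d \<odot> x" using coords_1[OF assms(1)] by blast
    have add: "\<Delta> (y + z) = \<Delta> y + \<Delta> z" and scale: "\<Delta> (e \<odot> y) = e \<odot> \<Delta> y" for y z e
      using lin by (simp_all add: Vector_Spaces.linear_iff)
    have diff: "\<Delta> (y - z) = \<Delta> y - \<Delta> z" for y z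
      using add[of "y - z" z] by simp
    show ?thesis
      using fn_x x_x f_f[of 1 1] x_fn assms(1)
      by (simp add: u v p[simplified] r add scale diff bracket_add_left bracket_add_right bracket_scale_left
          bracket_scale_right scale_right_distrib scale_right_diff_distrib scale_left_diff_distrib scale_left_distrib
          algebra_simps)
  qed
  with lin show ?thesis by (simp add: derivation_def)
qed

end

theory Submission
  imports Defs
begin

text \<open>
  Write \<open>F\<close> for the span of the \<open>f i\<close> and \<open>R\<close> for right multiplication by \<open>x\<close>. In both algebras \<open>R\<close>
  kills \<open>x\<close>, and on \<open>F\<close> it is a single Jordan block \<open>1 + N\<close> with \<open>N (f i) = f (i + 1)\<close>,
  \<open>N (f n) = 0\<close>. Moreover \<open>F\<close> is abelian and contains the image of \<open>R\<close>. As the two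
  algebras share these facts, one argument covers both.

  By the Leibniz identity \<open>R\<close> is a derivation. Since \<open>F\<close> is abelian, the mixed terms vanish when
  derivations with values in \<open>F\<close> are composed, so that every polynomial in \<open>R\<close> without constant term
  is again a derivation. In particular \<open>(R - 1)\<^sup>k R\<close> is one; on \<open>F\<close> it acts as \<open>N\<^sup>k (1 + N)\<close>.

  Now let \<open>\<Delta>\<close> be the projection onto the line of \<open>f n\<close> that kills all other basis vectors.
  If \<open>a f i\<close> is the leading term of \<open>v \<in> F\<close>, that is, the nonzero one of least index,
  then \<open>(R - 1)\<^sup>n\<^sup>-\<^sup>i R\<close> sends \<open>v\<close> to \<open>a f n\<close>, and a multiple of this derivation agrees with \<open>\<Delta>\<close> at \<open>v\<close>.
  All maps involved kill \<open>x\<close>, so \<open>\<Delta>\<close> is a local derivation. But derivations that kill \<open>x\<close>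
  commute with \<open>R\<close>, while \<open>\<Delta> (R (f (n - 1))) = f n\<close> and \<open>R (\<Delta> (f (n - 1))) = 0\<close>.
\<close>

section \<open>Operations on derivations\<close>

context leibniz_algebra
begin

lemma linear_scale_scale_iff:
  "Vector_Spaces.linear scale scale D \<longleftrightarrow>
     (\<forall>a b. D (a + b) = D a + D b) \<and> (\<forall>r a. D (r \<odot> a) = r \<odot> D a)"
  by (simp add: Vector_Spaces.linear_iff vector_space_axioms)

lemma derivation_zero: "derivation D \<Longrightarrow> D 0 = 0"
  using derivationD(1)[of D 0 0] by simp

lemma derivation_0: "derivation (\<lambda>_. 0)"
  by (simp add: derivation_def linear_scale_scale_iff bracket_zero_left bracket_zero_right)

lemma derivation_scale: "derivation D \<Longrightarrow> derivation (\<lambda>u. c \<odot> D u)"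
  by (simp add: derivation_def linear_scale_scale_iff bracket_scale_left bracket_scale_right
      scale_right_distrib scale_left_commute)

lemma derivation_diff:
  assumes "derivation D" "derivation E"
  shows "derivation (\<lambda>u. D u - E u)"
proof -
  have "\<lbrakk>a - a', b\<rbrakk> = \<lbrakk>a, b\<rbrakk> - \<lbrakk>a', b\<rbrakk>" "\<lbrakk>b, a - a'\<rbrakk> = \<lbrakk>b, a\<rbrakk> - \<lbrakk>b, a'\<rbrakk>" for a a' b
    using bracket_add_left[of "a - a'" a' b] bracket_add_right[of b "a - a'" a'] by simp_all
  then show ?thesis
    using assms by (simp add: derivation_def linear_scale_scale_iff scale_right_diff_distrib)
qed

text \<open>The Leibniz identity is the product rule for right multiplications, up to the order of terms.\<close>

lemma derivation_right_mult: "derivation (\<lambda>u. \<lbrakk>u, c\<rbrakk>)"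
  using leibniz by (simp add: derivation_def bracket_linear_left)

text \<open>
  The two assumed identities make the mixed terms of the second-order product rule vanish.
\<close>

lemma derivation_comp:
  assumes D: "derivation D" and E: "derivation E"
    and "\<And>a b. \<lbrakk>D a, E b\<rbrakk> = 0" "\<And>a b. \<lbrakk>E a, D b\<rbrakk> = 0"
  shows "derivation (\<lambda>u. D (E u))"
  using assms(3,4) unfolding derivation_def linear_scale_scale_iff
  by (simp add: derivationD[OF D] derivationD[OF E])

end

section \<open>Jordan block extensions of abelian ideals\<close>

text \<open>
  The common part of the two multiplication tables, which differ only in left multiplication
  by \<open>x\<close>.
\<close>

locale jordan_block_extension = leibniz_algebra_basis scale bracket n f x
  for scale :: "complex \<Rightarrow> 'a::ab_group_add \<Rightarrow> 'a" (infixr \<open>\<odot>\<close> 75)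
    and bracket :: "'a \<Rightarrow> 'a \<Rightarrow> 'a" (\<open>\<lbrakk>_,/ _\<rbrakk>\<close>) and n f x +
  assumes f_x: "\<And>i. 1 \<le> i \<Longrightarrow> i \<le> n - 1 \<Longrightarrow> \<lbrakk>f i, x\<rbrakk> = f i + f (i + 1)"
    and fn_x: "\<lbrakk>f n, x\<rbrakk> = f n"
    and f_f: "\<And>i j. 1 \<le> i \<Longrightarrow> i \<le> n \<Longrightarrow> 1 \<le> j \<Longrightarrow> j \<le> n \<Longrightarrow> \<lbrakk>f i, f j\<rbrakk> = 0"
    and x_x: "\<lbrakk>x, x\<rbrakk> = 0"

sublocale R1 \<subseteq> jordan_block_extension
  by unfold_locales (fact f_x fn_x f_f x_x)+

sublocale R2 \<subseteq> jordan_block_extension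
  by unfold_locales (fact f_x fn_x f_f x_x)+

context jordan_block_extension
begin

text \<open>
  Continuing the basis of the Jordan block by zero makes \<open>[f i, x] = f i + f (i + 1)\<close> hold at
  \<open>i = n\<close> too.
\<close>

definition f0 :: "nat \<Rightarrow> 'a" where
  "f0 i = (if i \<le> n then f i else 0)"

lemma f0_x: "1 \<le> i \<Longrightarrow> \<lbrakk>f0 i, x\<rbrakk> = f0 i + f0 (i + 1)"
  using f_x[of i] fn_x by (cases "i < n"; cases "i = n") (auto simp: f0_def bracket_zero_left)

lemma x_mult_in_span: "\<lbrakk>u, x\<rbrakk> \<in> span (f ` {1..n})"
proof (rule bracket_in_subspace[of _ "insert x (f ` {1..n})" "{x}"])
  fix a b
  assume a: "a \<in> insert x (f ` {1..n})" and b: "b \<in> {x}"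
  have "\<lbrakk>f i, x\<rbrakk> \<in> span (f ` {1..n})" if "1 \<le> i" "i \<le> n" for i
  proof -
    have "f0 j \<in> span (f ` {1..n})" if "1 \<le> j" for j
      using that by (simp add: f0_def f_in_span span_zero del: One_nat_def)
    then have "f0 i + f0 (i + 1) \<in> span (f ` {1..n})"
      using that by (intro span_add) simp_all
    then show ?thesis
      using f0_x[of i] that by (simp add: f0_def)
  qed
  with a b show "\<lbrakk>a, b\<rbrakk> \<in> span (f ` {1..n})"
    by (auto simp: x_x span_zero)
qed (simp_all add: span_basis span_base del: One_nat_def)

lemma span_f_abelian:
  assumes "u \<in> span (f ` {1..n})" "v \<in> span (f ` {1..n})"
  shows "\<lbrakk>u, v\<rbrakk> = 0"
proof -
  have "\<lbrakk>u, v\<rbrakk> \<in> {0}"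
    by (rule bracket_in_subspace[OF _ _ assms]) (auto simp: f_f)
  then show ?thesis by simp
qed

text \<open>The derivation \<open>(R - 1)\<^sup>k R\<close>, where \<open>R\<close> is right multiplication by \<open>x\<close>.\<close>

fun shift_derivation :: "nat \<Rightarrow> 'a \<Rightarrow> 'a" where
  "shift_derivation 0 u = \<lbrakk>u, x\<rbrakk>"
| "shift_derivation (Suc k) u = \<lbrakk>shift_derivation k u, x\<rbrakk> - shift_derivation k u"

lemma shift_derivation_in_span: "shift_derivation k u \<in> span (f ` {1..n})"
  by (induction k) (simp_all add: x_mult_in_span span_diff del: One_nat_def)

lemma derivation_shift_derivation: "derivation (shift_derivation k)"
proof (induction k)
  case 0
  then show ?case by (simp add: derivation_right_mult)
next
  case (Suc k)
  have "derivation (\<lambda>u. \<lbrakk>shift_derivation k u, x\<rbrakk>)"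
    by (rule derivation_comp[OF derivation_right_mult Suc])
      (rule span_f_abelian; rule x_mult_in_span shift_derivation_in_span)+
  from derivation_diff[OF this Suc] show ?case by simp
qed

lemma shift_derivation_x: "shift_derivation k x = 0"
  by (induction k) (simp_all add: x_x bracket_zero_left)

text \<open>
  The terms \<open>f0 i\<close> form a Jordan chain, and \<open>R - 1\<close> advances it by one step. A chain element that
  starts \<open>k\<close> places before the end thus lands on \<open>f n\<close>, and all later ones are pushed off the end.
\<close>

lemma shift_derivation_f0:
  assumes "1 \<le> i"
  shows "shift_derivation k (f0 i) = \<lbrakk>f0 (i + k), x\<rbrakk>"
proof (induction k)
  case (Suc k)
  then show ?case
    using assms f0_x[of "i + k"] by (simp add: bracket_add_left)
qed simp

lemma shift_derivation_f: "1 \<le> i \<Longrightarrow> i \<le> n \<Longrightarrow> shift_derivation (n - i) (f i) = f n"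
  using shift_derivation_f0[of i "n - i"] fn_x by (simp add: f0_def)

lemma shift_derivation_span_tail:
  assumes "n < i + k" "1 \<le> i" "v \<in> span (f ` {i..n})"
  shows "shift_derivation k v = 0"
  using assms(3)
proof (induction rule: span_induct_alt)
  case base
  then show ?case by (rule derivation_zero[OF derivation_shift_derivation])
next
  case (step c y z)
  from step(1) obtain j where "i \<le> j" "j \<le> n" "y = f j" by auto
  then have "shift_derivation k y = 0"
    using shift_derivation_f0[of j k] assms(1,2) by (simp add: f0_def bracket_zero_left)
  with step(2) show ?case
    by (simp add: derivationD[OF derivation_shift_derivation])
qed

section \<open>Projection onto the line of the last basis vector\<close>

text \<open>
  The induction looks for the leading term of \<open>v\<close>: as long as the coefficient of \<open>f i\<close> is zero,
  it moves on to the tail. The condition \<open>D x = 0\<close> is what allows a later passage from \<open>v\<close> to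
  \<open>v + b x\<close>.
\<close>

lemma derivation_onto_last:
  assumes "1 \<le> i" "i \<le> n + 1" "v \<in> span (f ` {i..n})" "v = 0 \<Longrightarrow> w = 0" "w \<in> span {f n}"
  shows "\<exists>D. derivation D \<and> D x = 0 \<and> D v = w"
  using assms(2,1,3)
proof (induction rule: inc_induct)
  case base
  with assms(4) have "v = 0" "w = 0" by auto
  then show ?case using derivation_0 by blast
next
  case (step i)
  have "{i..n} = insert i {Suc i..n}" using step(2) by auto
  with step(5) have "v \<in> span (insert (f i) (f ` {Suc i..n}))" by simp
  then obtain a where tail: "v - a \<odot> f i \<in> span (f ` {Suc i..n})"
    unfolding span_insert by blast
  show ?case
  proof (cases "a = 0")
    case True
    with tail step.IH show ?thesis by simp
  next
    case False
    let ?D = "shift_derivation (n - i)"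
    note D = derivation_shift_derivation[of "n - i"]
    obtain b where w: "w = b \<odot> f n"
      using assms(5) unfolding span_singleton by blast
    have "?D v = ?D (a \<odot> f i) + ?D (v - a \<odot> f i)"
      using derivationD(1)[OF D, of "a \<odot> f i" "v - a \<odot> f i"] by simp
    also have "\<dots> = a \<odot> f n"
      using shift_derivation_span_tail[OF _ _ tail, of "n - i"] shift_derivation_f[of i] step
      by (simp add: derivationD(2)[OF D])
    finally have "(b / a) \<odot> ?D v = w"
      using False by (simp add: w)
    moreover have "derivation (\<lambda>u. (b / a) \<odot> ?D u)"
      by (rule derivation_scale[OF D])
    moreover have "(b / a) \<odot> ?D x = 0"
      by (simp add: shift_derivation_x)
    ultimately show ?thesis by blast
  qed
qed

lemma exists_local_derivation_not_derivation:
  assumes "2 \<le> n"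
  shows "\<exists>\<Delta>. local_derivation \<Delta> \<and> \<not> derivation \<Delta>"
proof -
  let ?B = "insert x (f ` {1..n})"
  interpret vector_space_pair scale scale ..
  obtain \<Delta> where lin: "Vector_Spaces.linear scale scale \<Delta>"
    and on_B: "\<forall>b\<in>?B. \<Delta> b = (if b = f n then f n else 0)"
    using linear_independent_extend[OF independent_basis, of "\<lambda>b. if b = f n then f n else 0"]
    by blast
  have fn_in: "f n \<in> f ` {1..n}" using assms by auto
  have \<Delta>x: "\<Delta> x = 0" and \<Delta>n: "\<Delta> (f n) = f n"
    using on_B fn_in x_notin by auto
  have "f (n - 1) \<noteq> f n"
    using inj_onD[OF inj_f, of "n - 1" n] assms by fastforce
  then have \<Delta>n': "\<Delta> (f (n - 1)) = 0"
    using on_B assms by auto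
  have add: "\<Delta> (u + v) = \<Delta> u + \<Delta> v" and scale: "\<Delta> (r \<odot> u) = r \<odot> \<Delta> u" for u v r
    using lin by (simp_all add: linear_scale_scale_iff)
  have \<Delta>_range: "\<Delta> u \<in> span {f n}" for u
  proof -
    have "u \<in> span ?B" by (simp only: span_basis UNIV_I)
    then show ?thesis
    proof (induction rule: span_induct_alt)
      case base
      then show ?case using scale[of 0 0] by (simp add: span_zero)
    next
      case (step c y z)
      then have "\<Delta> y \<in> span {f n}" using on_B by (auto simp: span_zero span_base)
      with step show ?case by (simp add: add scale span_add span_scale)
    qed
  qed
  have "\<exists>D. derivation D \<and> \<Delta> u = D u" for u
  proof -
    have "u \<in> span ?B" by (simp only: span_basis UNIV_I)
    then obtain b where b: "u - b \<odot> x \<in> span (f ` {1..n})"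
      unfolding span_insert by blast
    define v where "v = u - b \<odot> x"
    have u: "u = v + b \<odot> x" by (simp add: v_def)
    have "v = 0 \<Longrightarrow> \<Delta> v = 0" using scale[of 0 0] by simp
    then obtain D where D: "derivation D" "D x = 0" "D v = \<Delta> v"
      using derivation_onto_last[of 1 v "\<Delta> v"] b \<Delta>_range by (auto simp: v_def)
    then have "\<Delta> u = D u"
      by (simp add: u add scale \<Delta>x derivationD)
    with D(1) show ?thesis by blast
  qed
  with lin have "local_derivation \<Delta>" by (simp add: local_derivation_def)
  moreover have "\<not> derivation \<Delta>"
  proof
    assume "derivation \<Delta>"
    from derivationD(3)[OF this, of "f (n - 1)" x]
    have "\<Delta> \<lbrakk>f (n - 1), x\<rbrakk> = 0"
      by (simp only: \<Delta>n' \<Delta>x bracket_zero_left bracket_zero_right add_0)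
    moreover have "\<lbrakk>f (n - 1), x\<rbrakk> = f (n - 1) + f n"
      using f_x[of "n - 1"] assms by simp
    ultimately have "f n = 0" by (simp only: add \<Delta>n \<Delta>n' add_0)
    with fn_in have "0 \<in> ?B" by simp
    from dependent_zero[OF this] independent_basis show False by contradiction
  qed
  ultimately show ?thesis by blast
qed

end

theorem theorem3p3:
  fixes scale :: "complex \<Rightarrow> 'a::ab_group_add \<Rightarrow> 'a"
    and bracket :: "'a \<Rightarrow> 'a \<Rightarrow> 'a"
    and n :: nat and f :: "nat \<Rightarrow> 'a" and x :: 'a
  assumes "n \<ge> 2"
  shows "(R1 scale bracket n f x \<longrightarrow>
           (\<exists>\<Delta>. leibniz_algebra.local_derivation scale bracket \<Delta> \<and>
                \<not> leibniz_algebra.derivation scale bracket \<Delta>)) \<and>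
         (R2 scale bracket n f x \<longrightarrow>
           (\<exists>\<Delta>. leibniz_algebra.local_derivation scale bracket \<Delta> \<and>
                \<not> leibniz_algebra.derivation scale bracket \<Delta>))"
proof (intro conjI impI)
  assume "R1 scale bracket n f x"
  then interpret R1 scale bracket n f x .
  show "\<exists>\<Delta>. local_derivation \<Delta> \<and> \<not> derivation \<Delta>"
    by (rule exists_local_derivation_not_derivation[OF assms])
next
  assume "R2 scale bracket n f x"
  then interpret R2 scale bracket n f x .
  show "\<exists>\<Delta>. local_derivation \<Delta> \<and> \<not> derivation \<Delta>"
    by (rule exists_local_derivation_not_derivation[OF assms])
qed

end
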